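(* Let $d\geq 1$ and let $\{T^u\}_{u\in\mathbb{Z}^d}$ be an action of $\mathbb{Z}^d$ by homeomorphisms on a compact metric space $X$. If the action is topologically predictable, then it has topological entropy zero.
   Context: For $f\in C(X)$ and $u\in\mathbb{Z}^d$ write $T^uf=f\circ T^u$. For a family $\mathcal{F}\subseteq C(X)$, $\langle\mathcal{F}\rangle\subseteq C(X)$ denotes the closed (in the sup norm) algebra generated by $\mathcal{F}$. Let $<$ be the lexicographical ordering on $\mathbb{Z}^d$. The action $\{T^u\}_{u\in\mathbb{Z}^d}$ is topologically predictable (TP) if $f\in\langle 1,\,T^uf : u<0\rangle$ for every $f\in C(X)$. Topological entropy is the topological entropy of the $\mathbb{Z}^d$-action. *)

theory Defs
  imports "HOL-Analysis.Analysis"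
begin

(* The group Z^d is rendered as int ^ 'n with d = CARD('n).  The index type carries a linear
   order, which is what the lexicographical ordering refers to (the ordering of int ^ 'n in the
   library is the componentwise one). *)

definition lex_less :: "int ^ 'n::{finite,linorder} \<Rightarrow> int ^ 'n::{finite,linorder} \<Rightarrow> bool"  (infix \<open>\<prec>\<close> 50) where
  "u \<prec> v \<longleftrightarrow> (\<exists>i. (\<forall>j<i. u $ j = v $ j) \<and> u $ i < v $ i)"

definition homeo_action :: "'a::metric_space set \<Rightarrow> (int ^ 'n::finite \<Rightarrow> 'a \<Rightarrow> 'a) \<Rightarrow> bool" where
  "homeo_action X T \<longleftrightarrow>
     (\<forall>u. homeomorphic_map (top_of_set X) (top_of_set X) (T u)) \<and>
     (\<forall>x\<in>X. T 0 x = x) \<and>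
     (\<forall>u v. \<forall>x\<in>X. T (u + v) x = T u (T v x))"

(* Elements of C(X) are functions on the ambient type that are continuous on X; their values
   outside X are irrelevant, since the rule limit closes the set under equality on X.  Closedness
   in the sup norm over X is closedness under sequences converging uniformly on X. *)

inductive_set closed_algebra :: "'a::metric_space set \<Rightarrow> ('a \<Rightarrow> real) set \<Rightarrow> ('a \<Rightarrow> real) set"
  for X F where
  zero: "(\<lambda>_. 0) \<in> closed_algebra X F"
| gen: "f \<in> F \<Longrightarrow> f \<in> closed_algebra X F"
| add: "f \<in> closed_algebra X F \<Longrightarrow> g \<in> closed_algebra X F \<Longrightarrow> (\<lambda>x. f x + g x) \<in> closed_algebra X F"
| mult: "f \<in> closed_algebra X F \<Longrightarrow> g \<in> closed_algebra X F \<Longrightarrow> (\<lambda>x. f x * g x) \<in> closed_algebra X F"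
| scale: "f \<in> closed_algebra X F \<Longrightarrow> (\<lambda>x. c * f x) \<in> closed_algebra X F"
| limit: "(\<And>n. g n \<in> closed_algebra X F) \<Longrightarrow> uniform_limit X g f sequentially
           \<Longrightarrow> f \<in> closed_algebra X F"

definition topologically_predictable ::
    "'a::metric_space set \<Rightarrow> (int ^ 'n::{finite,linorder} \<Rightarrow> 'a \<Rightarrow> 'a) \<Rightarrow> bool" where
  "topologically_predictable X T \<longleftrightarrow>
     (\<forall>f. continuous_on X f \<longrightarrow> f \<in> closed_algebra X (insert (\<lambda>_. 1) {f \<circ> T u | u. u \<prec> 0}))"

definition open_cover :: "'a::metric_space set \<Rightarrow> 'a set set \<Rightarrow> bool" where
  "open_cover X \<U> \<longleftrightarrow> (\<forall>A\<in>\<U>. openin (top_of_set X) A) \<and> \<Union>\<U> = X"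

definition box_Zd :: "nat \<Rightarrow> (int ^ 'n::finite) set" where
  "box_Zd n = {u. \<forall>i. 0 \<le> u $ i \<and> u $ i < int n}"

(* The join of the covers T^(-u) \<U>, u \<in> K. *)

definition cover_join ::
    "'a::metric_space set \<Rightarrow> (int ^ 'n::finite \<Rightarrow> 'a \<Rightarrow> 'a) \<Rightarrow> 'a set set \<Rightarrow> (int ^ 'n) set \<Rightarrow> 'a set set" where
  "cover_join X T \<U> K = {{x\<in>X. \<forall>u\<in>K. T u x \<in> g u} | g. \<forall>u\<in>K. g u \<in> \<U>}"

definition cover_number :: "'a set \<Rightarrow> 'a set set \<Rightarrow> nat" where
  "cover_number X \<V> = (LEAST k. \<exists>\<W>\<subseteq>\<V>. finite \<W> \<and> card \<W> = k \<and> X \<subseteq> \<Union>\<W>)"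

(* Adler-Konheim-McAndrew entropy.  The limit in n exists by subadditivity, so limsup is that
   limit.  For X = {} the covering numbers are 0 and ln 0 = 0 makes the entropy 0. *)

definition cover_entropy ::
    "'a::metric_space set \<Rightarrow> (int ^ 'n::finite \<Rightarrow> 'a \<Rightarrow> 'a) \<Rightarrow> 'a set set \<Rightarrow> ereal" where
  "cover_entropy X T \<U> =
     limsup (\<lambda>n. ereal (ln (real (cover_number X (cover_join X T \<U> (box_Zd n)))) / real n ^ CARD('n)))"

definition topological_entropy ::
    "'a::metric_space set \<Rightarrow> (int ^ 'n::finite \<Rightarrow> 'a \<Rightarrow> 'a) \<Rightarrow> ereal" where
  "topological_entropy X T = (SUP \<U>\<in>{\<U>. open_cover X \<U>}. cover_entropy X T \<U>)"

end

theory Submission imports Defs begin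

text \<open>
  The proof is a direct counting argument; it uses no invariant measures.

  Suppose that an open cover has entropy greater than \<open>h > 0\<close>, and let \<open>e\<close> be a Lebesgue number of it. Then
  for infinitely many \<open>n\<close> there are sets \<open>E n\<close> of more than \<open>exp (h * n ^ d)\<close> points whose orbits
  are \<open>e\<close>-separated along the box of side \<open>n\<close> (\<open>separated_set_exists\<close>). Let \<open>P\<close> be a finite net. For
  \<open>p \<in> P\<close> let \<open>F p\<close> be a continuous function which is \<open>0\<close> near \<open>p\<close>, is \<open>1\<close> at some distance from \<open>p\<close>,
  and has a short transition in between. The names of the points of \<open>E n\<close>, that is, the values of the
  \<open>F p\<close> along the box, are distinct.

  Predictability says that a finite set of past values of \<open>F p\<close> determines the present value up to an
  error less than \<open>1\<close> (\<open>predictable_finite_past\<close>). Going through the box in lexicographic order,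
  the choice between the values \<open>0\<close> and \<open>1\<close> therefore carries no information except near
  the boundary of the box, and only the values taken in the transition zone need to be written
  down (\<open>card_le_of_predictable_codes\<close>).

  The difficulty is that the values in the transition zone must be known exactly, since the precision
  that the prediction demands depends on the function. An ordinary ramp would take too many
  values there. Instead the transition is a small copy of the Cantor function, whose
  distribution under Lebesgue measure is atomic and has finite entropy. The orbits are finite
  objects and not Lebesgue distributed, but the transition radius can be chosen at random:
  Fatou's lemma provides a single radius for which, for infinitely many \<open>n\<close>, the values along the orbits
  of \<open>E n\<close> lie on the plateaus and have small mean description length (\<open>good_shift_exists\<close>).
  Kraft's and Jensen's inequalities turn this into a bound on the number of names
  (\<open>card_le_of_level_cost\<close>) which contradicts the size of \<open>E n\<close>.
\<close>

section \<open>The Cantor function and its plateaus\<close>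

text \<open>
  These are the iterates whose limit is the Cantor function. Every iterate is \<open>0\<close> on the left of
  \<open>[0,1]\<close> and \<open>1\<close> on the right of it, so one formula covers the three thirds: one of the two
  summands is always constant.
\<close>

primrec cantor_approx :: "nat \<Rightarrow> real \<Rightarrow> real" where
  "cantor_approx 0 t = max 0 (min 1 t)"
| "cantor_approx (Suc j) t = (cantor_approx j (3 * t) + cantor_approx j (3 * t - 2)) / 2"

lemma cantor_approx_eq_0: "t \<le> 0 \<Longrightarrow> cantor_approx j t = 0"
  by (induction j arbitrary: t) auto

lemma cantor_approx_eq_1: "t \<ge> 1 \<Longrightarrow> cantor_approx j t = 1"
  by (induction j arbitrary: t) auto

lemma continuous_on_cantor_approx: "continuous_on UNIV (cantor_approx j)"
proof (induction j)
  case 0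
  show ?case by (auto intro!: continuous_intros)
next
  case (Suc j)
  show ?case
    unfolding cantor_approx.simps
    by (intro continuous_intros continuous_on_compose2[OF Suc]) auto
qed

text \<open>
  The halving in the recursion is a contraction because the difference of two iterates vanishes
  outside \<open>[0,1]\<close>, and \<open>3 * t\<close> and \<open>3 * t - 2\<close> never lie there at the same time.
\<close>

lemma cantor_approx_step: "\<bar>cantor_approx (Suc j) t - cantor_approx j t\<bar> \<le> (1/2) ^ j"
proof (induction j arbitrary: t)
  case 0
  have "0 \<le> cantor_approx 0 s" "cantor_approx 0 s \<le> 1" for s by auto
  from this[of t] this[of "3 * t"] this[of "3 * t - 2"]
  show ?case unfolding cantor_approx.simps(2) power_0 abs_le_iff by argo
next
  case (Suc j)
  let ?d = "\<lambda>j t. cantor_approx (Suc j) t - cantor_approx j t"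
  have split: "?d (Suc j) t = (?d j (3 * t) + ?d j (3 * t - 2)) / 2"
    unfolding cantor_approx.simps(2) by argo
  show ?case
  proof (cases "t \<le> 1/2")
    case True
    then have "?d j (3 * t - 2) = 0"
      using cantor_approx_eq_0[of "3*t-2"] by (simp del: cantor_approx.simps)
    then have "?d (Suc j) t = ?d j (3 * t) / 2" unfolding split by argo
    then show ?thesis using Suc[of "3*t"] by (simp only: abs_divide) simp
  next
    case False
    then have "?d j (3 * t) = 0"
      using cantor_approx_eq_1[of "3*t"] by (simp del: cantor_approx.simps)
    then have "?d (Suc j) t = ?d j (3 * t - 2) / 2" unfolding split by argo
    then show ?thesis using Suc[of "3*t-2"] by (simp only: abs_divide) simp
  qed
qed

lemma cantor_function_exists:
  obtains \<phi> :: "real \<Rightarrow> real" where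
    "continuous_on UNIV \<phi>" "\<And>t. t \<le> 0 \<Longrightarrow> \<phi> t = 0" "\<And>t. t \<ge> 1 \<Longrightarrow> \<phi> t = 1"
    "\<And>t. \<phi> t = (\<phi> (3 * t) + \<phi> (3 * t - 2)) / 2"
proof -
  let ?d = "\<lambda>j t. cantor_approx (Suc j) t - cantor_approx j t"
  define \<phi> where "\<phi> = (\<lambda>t. cantor_approx 0 t + (\<Sum>j. ?d j t))"
  have "uniform_limit UNIV (\<lambda>n t. \<Sum>j<n. ?d j t) (\<lambda>t. \<Sum>j. ?d j t) sequentially"
    by (rule Weierstrass_m_test[where M = "\<lambda>j. (1/2) ^ j"])
      (use cantor_approx_step in \<open>auto simp del: cantor_approx.simps\<close>)
  then have "uniform_limit UNIV (\<lambda>n t. cantor_approx 0 t + (\<Sum>j<n. ?d j t)) \<phi> sequentially"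
    unfolding \<phi>_def by (intro uniform_limit_add uniform_limit_const)
  moreover have "cantor_approx 0 t + (\<Sum>j<n. ?d j t) = cantor_approx n t" for n t
    by (subst sum_lessThan_telescope[of "\<lambda>j. cantor_approx j t" n]) (simp del: cantor_approx.simps)
  ultimately have lim: "uniform_limit UNIV cantor_approx \<phi> sequentially"
    by (simp del: cantor_approx.simps)
  have pt: "(\<lambda>n. cantor_approx n t) \<longlonglongrightarrow> \<phi> t" for t
    by (rule tendsto_uniform_limitI[OF lim]) simp
  show thesis
  proof
    show "continuous_on UNIV \<phi>"
      by (rule uniform_limit_theorem[OF _ lim]) (simp_all add: continuous_on_cantor_approx)
    show "\<phi> t = 0" if "t \<le> 0" for t
      using pt[of t] that by (simp add: cantor_approx_eq_0 LIMSEQ_const_iff)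
    show "\<phi> t = 1" if "t \<ge> 1" for t
      using pt[of t] that by (simp add: cantor_approx_eq_1 LIMSEQ_const_iff)
    show "\<phi> t = (\<phi> (3 * t) + \<phi> (3 * t - 2)) / 2" for t
    proof (rule LIMSEQ_unique)
      show "(\<lambda>n. cantor_approx (Suc n) t) \<longlonglongrightarrow> \<phi> t"
        using pt LIMSEQ_Suc by blast
      show "(\<lambda>n. cantor_approx (Suc n) t) \<longlonglongrightarrow> (\<phi> (3 * t) + \<phi> (3 * t - 2)) / 2"
        unfolding cantor_approx.simps by (intro tendsto_intros pt) simp
    qed
  qed
qed

text \<open>
  The values that the Cantor function takes on the two outer half-lines and on the gaps removed in
  the first \<open>j\<close> steps of the construction of the Cantor set: the multiples of \<open>1 / 2 ^ j\<close> in
  \<open>[0,1]\<close>. The recursion follows the functional equation of the Cantor function.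
\<close>

primrec dyadic :: "nat \<Rightarrow> real set" where
  "dyadic 0 = {0, 1}"
| "dyadic (Suc j) = (\<lambda>v. v / 2) ` dyadic j \<union> (\<lambda>v. (1 + v) / 2) ` dyadic j"

text \<open>
  The open intervals that remain after \<open>j\<close> steps of the construction of the Cantor set. Outside
  them the value of the Cantor function is already settled.
\<close>

primrec unresolved :: "nat \<Rightarrow> real set" where
  "unresolved 0 = {0<..<1}"
| "unresolved (Suc j) = {t. 3 * t \<in> unresolved j \<or> 3 * t - 2 \<in> unresolved j}"

lemma finite_dyadic: "finite (dyadic j)"
  by (induction j) auto

lemma card_dyadic: "card (dyadic j) \<le> 2 ^ Suc j"
proof (induction j)
  case (Suc j)
  have "card (dyadic (Suc j)) \<le> card ((\<lambda>v. v / 2) ` dyadic j) + card ((\<lambda>v. (1 + v) / 2) ` dyadic j)"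
    by (simp add: card_Un_le)
  also have "\<dots> \<le> card (dyadic j) + card (dyadic j)"
    by (intro add_mono card_image_le finite_dyadic)
  finally show ?case using Suc by simp
qed simp

lemma dyadic_mono: "i \<le> j \<Longrightarrow> dyadic i \<subseteq> dyadic j"
proof (rule lift_Suc_mono_le[of dyadic])
  show "dyadic n \<subseteq> dyadic (Suc n)" for n
    by (induction n) (auto simp: image_iff)
qed

lemma cantor_function_resolved:
  assumes "\<And>t. t \<le> 0 \<Longrightarrow> \<phi> t = 0" "\<And>t. t \<ge> 1 \<Longrightarrow> \<phi> t = 1"
    and rec: "\<And>t. \<phi> t = (\<phi> (3 * t) + \<phi> (3 * t - 2)) / (2::real)"
  shows "t \<notin> unresolved j \<Longrightarrow> \<phi> t \<in> dyadic j"
proof (induction j arbitrary: t)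
  case 0
  then show ?case using assms(1,2)[of t] by auto
next
  case (Suc j)
  then have IH: "\<phi> (3 * t) \<in> dyadic j" "\<phi> (3 * t - 2) \<in> dyadic j" by auto
  show ?case
  proof (cases "t \<le> 1/2")
    case True
    then have "\<phi> t = \<phi> (3 * t) / 2" using rec[of t] assms(1)[of "3*t-2"] by simp
    then show ?thesis using IH by auto
  next
    case False
    then have "\<phi> t = (1 + \<phi> (3 * t - 2)) / 2" using rec[of t] assms(2)[of "3*t"] by simp
    then show ?thesis using IH by auto
  qed
qed

lemma unresolved_measurable [measurable]: "unresolved j \<in> sets borel"
proof (induction j)
  case (Suc j)
  have "(\<lambda>t. 3 * t) -` unresolved j \<inter> space borel \<in> sets borel" 
    "(\<lambda>t. 3 * t - 2) -` unresolved j \<inter> space borel \<in> sets (borel :: real measure)"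
    by (rule measurable_sets[OF _ Suc]; measurable)+
  moreover have "unresolved (Suc j) = (\<lambda>t. 3 * t) -` unresolved j \<union> (\<lambda>t. 3 * t - 2) -` unresolved j"
    by auto
  ultimately show ?case by simp
qed simp

lemma unresolved_measure: "emeasure lborel (unresolved j) \<le> ennreal ((2/3) ^ j)"
proof (induction j)
  case (Suc j)
  have aff: "(\<integral>\<^sup>+t. indicator (unresolved j) (b + 3 * t) \<partial>lborel) \<le> ennreal ((1/3) * (2/3) ^ j)" for b :: real
  proof -
    have "emeasure lborel (unresolved j) = 3 * (\<integral>\<^sup>+t. indicator (unresolved j) (b + 3 * t) \<partial>lborel)"
      by (subst nn_integral_indicator[symmetric], simp,
          subst nn_integral_real_affine[where c = 3 and t = b]) auto
    with Suc have "3 * (\<integral>\<^sup>+t. indicator (unresolved j) (b + 3 * t) \<partial>lborel) \<le> ennreal ((2/3) ^ j)"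
      by simp
    then have "ennreal (1/3) * (3 * (\<integral>\<^sup>+t. indicator (unresolved j) (b + 3 * t) \<partial>lborel)) \<le> ennreal (1/3) * ennreal ((2/3) ^ j)"
      by (rule mult_left_mono) simp
    moreover have "ennreal (1/3) * 3 = 1"
      using ennreal_mult[of "1/3" 3] by simp
    ultimately show ?thesis
      by (simp add: mult.assoc[symmetric] ennreal_mult[symmetric])
  qed
  have "emeasure lborel (unresolved (Suc j)) = (\<integral>\<^sup>+t. indicator (unresolved (Suc j)) t \<partial>lborel)"
    by (simp del: unresolved.simps)
  also have "\<dots> \<le> (\<integral>\<^sup>+t. indicator (unresolved j) (0 + 3 * t) + indicator (unresolved j) (-2 + 3 * t) \<partial>lborel)"
    by (rule nn_integral_mono) (auto simp: indicator_def)
  also have "\<dots> = (\<integral>\<^sup>+t. indicator (unresolved j) (0 + 3 * t) \<partial>lborel) + (\<integral>\<^sup>+t. indicator (unresolved j) (-2 + 3 * t) \<partial>lborel)"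
    by (rule nn_integral_add) measurable
  also have "\<dots> \<le> ennreal ((1/3) * (2/3) ^ j) + ennreal ((1/3) * (2/3) ^ j)"
    by (intro add_mono aff)
  also have "\<dots> = ennreal ((2/3) ^ Suc j)"
    by (simp add: ennreal_plus[symmetric] del: ennreal_plus)
  finally show ?case .
qed simp

section \<open>The description length of a value of the Cantor function\<close>

text \<open>
  The price, in nats, of naming a value of the Cantor function that appears at level \<open>j\<close>. The two
  values of level \<open>0\<close> are free. The rate \<open>2\<close> satisfies \<open>2 < exp 2\<close>, so that the \<open>2 ^ j + 1\<close>
  values of level \<open>j\<close> have summable weights \<open>exp (- price)\<close>; the entry fee \<open>M\<close> makes the sum of
  these weights small.
\<close>

definition level_cost :: "real \<Rightarrow> nat \<Rightarrow> real" where
  "level_cost M j = (if j = 0 then 0 else M + 2 * real j)"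

text \<open>
  The price of the value of the Cantor function at \<open>t\<close>, written as a sum of increments, one for each
  step at which \<open>t\<close> is still unresolved. It is infinite on the points that are never resolved.
\<close>

definition cost :: "real \<Rightarrow> real \<Rightarrow> ennreal" where
  "cost M t = (\<Sum>j. ennreal (level_cost M (Suc j) - level_cost M j) * indicator (unresolved j) t)"

lemma cost_measurable [measurable]: "cost M \<in> borel_measurable borel"
  unfolding cost_def by measurable

text \<open>
  The Cantor function has finite entropy with respect to Lebesgue measure: the measure of the
  unresolved part decays like \<open>(2/3) ^ j\<close> while the price grows linearly in \<open>j\<close>.
\<close>

lemma nn_integral_cost:
  assumes "M \<ge> 0"
  shows "(\<integral>\<^sup>+t. cost M t \<partial>lborel) \<le> ennreal (M + 6)"
proof -
  have "(\<integral>\<^sup>+t. cost M t \<partial>lborel) = (\<Sum>j. ennreal (level_cost M (Suc j) - level_cost M j) * emeasure lborel (unresolved j))"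
    unfolding cost_def by (subst nn_integral_suminf) (auto simp: nn_integral_cmult)
  also have "\<dots> \<le> (\<Sum>j. ennreal (level_cost M (Suc j) - level_cost M j) * ennreal ((2/3) ^ j))"
    by (intro suminf_le mult_left_mono unresolved_measure) auto
  also have "\<dots> = (\<Sum>j. ennreal ((if j = 0 then M else 0) + 2 * (2/3) ^ j))"
    using assms by (intro suminf_cong) (auto simp: level_cost_def ennreal_mult[symmetric])
  also have "\<dots> = ennreal (M + 6)"
  proof (rule suminf_ennreal_eq)
    have "(\<lambda>j. (if j = 0 then M else 0) + 2 * (2/3) ^ j) sums (M + 2 * (1 / (1 - 2/3)))"
      using sums_single[of 0 "\<lambda>_. M"] by (intro sums_add sums_mult geometric_sums) auto
    then show "(\<lambda>j. (if j = 0 then M else 0) + 2 * (2/3) ^ j) sums (M + 6)" by simp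
  qed (use assms in auto)
  finally show ?thesis .
qed

text \<open>
  This is what a finite price is good for: the value is then one of the finitely many values of
  some level \<open>j\<close>, and that level has been paid for.
\<close>

lemma cost_level:
  assumes "cost M t < \<infinity>" "M \<ge> 0"
  obtains j where "t \<notin> unresolved j" "ennreal (level_cost M j) \<le> cost M t"
proof -
  have partial: "ennreal (level_cost M n) \<le> cost M t" if "\<forall>i<n. t \<in> unresolved i" for n
  proof -
    have "level_cost M n = (\<Sum>i<n. level_cost M (Suc i) - level_cost M i)"
      by (subst sum_lessThan_telescope) (simp add: level_cost_def)
    also have "ennreal \<dots> = (\<Sum>i<n. ennreal (level_cost M (Suc i) - level_cost M i))"
      using assms by (intro sum_ennreal[symmetric]) (auto simp: level_cost_def)
    also have "\<dots> = (\<Sum>i<n. ennreal (level_cost M (Suc i) - level_cost M i) * indicator (unresolved i) t)"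
      using that by (intro sum.cong) auto
    also have "\<dots> \<le> cost M t"
      unfolding cost_def by (intro sum_le_suminf) auto
    finally show ?thesis .
  qed
  have "\<exists>j. t \<notin> unresolved j"
  proof (rule ccontr)
    assume "\<not> ?thesis"
    then have le: "ennreal (level_cost M n) \<le> cost M t" for n using partial by auto
    obtain r where r: "cost M t = ennreal r" "r \<ge> 0"
      using assms(1) by (cases "cost M t") auto
    obtain n :: nat where "r < real n" using reals_Archimedean2 by blast
    then have "r < level_cost M (Suc n)" using assms by (simp add: level_cost_def)
    with le[of "Suc n"] r show False by (simp add: ennreal_le_iff)
  qed
  then have "t \<notin> unresolved (LEAST j. t \<notin> unresolved j)" by (metis LeastI)
  moreover have "\<forall>i<(LEAST j. t \<notin> unresolved j). t \<in> unresolved i"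
    using not_less_Least by blast
  ultimately show thesis using that partial by blast
qed

text \<open>
  The Kraft sum. A value has weight \<open>exp (- level_cost M j)\<close> for every level \<open>j\<close> at which it occurs,
  so that no minimal level has to be singled out; this overcounts only by a geometric series.
\<close>

lemma sum_dyadic_weights:
  assumes "finite A"
  shows "(\<Sum>v\<in>A. \<Sum>j\<le>J. if v \<in> dyadic j then exp (- level_cost M j) else 0)
     \<le> real (card (A \<inter> {0, 1})) + 2 * exp (- M)"
proof -
  have level: "real (card (A \<inter> dyadic (Suc i))) * exp (- level_cost M (Suc i)) \<le> exp (- M) * (1/2) ^ i" for i
  proof -
    have "card (A \<inter> dyadic (Suc i)) \<le> 2 ^ Suc (Suc i)"
      using card_mono[OF finite_dyadic, of "A \<inter> dyadic (Suc i)" "Suc i"] card_dyadic[of "Suc i"] by auto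
    then have "real (card (A \<inter> dyadic (Suc i))) \<le> 4 * 2 ^ i"
      using of_nat_mono[where 'a=real] by fastforce
    moreover have "exp (- level_cost M (Suc i)) \<le> exp (- M) * (1/4) ^ Suc i"
    proof -
      have "(2::real)\<^sup>2 \<le> exp 1 ^ 2"
        using exp_ge_add_one_self[of 1] by (intro power_mono) auto
      then have "exp (2::real) \<ge> 4" by (simp add: exp_of_nat_mult[symmetric])
      then have "exp (-2::real) \<le> 1/4" by (simp add: exp_minus divide_simps)
      then have "exp (-2::real) ^ Suc i \<le> (1/4) ^ Suc i" by (intro power_mono) auto
      moreover have "exp (- level_cost M (Suc i)) = exp (- M) * exp (-2) ^ Suc i"
        by (simp add: level_cost_def exp_of_nat_mult[symmetric] exp_add[symmetric] algebra_simps del: power_Suc)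
      ultimately show ?thesis by simp
    qed
    ultimately have "real (card (A \<inter> dyadic (Suc i))) * exp (- level_cost M (Suc i)) \<le> (4 * 2 ^ i) * (exp (- M) * (1/4) ^ Suc i)"
      by (intro mult_mono) auto
    also have "\<dots> = exp (- M) * ((2::real) ^ i * (1/4) ^ i)" by simp
    also have "(2::real) ^ i * (1/4) ^ i = (1/2) ^ i"
      unfolding power_mult_distrib[symmetric] by simp
    finally show ?thesis .
  qed
  have "(\<Sum>v\<in>A. \<Sum>j\<le>J. if v \<in> dyadic j then exp (- level_cost M j) else 0)
      = (\<Sum>j\<le>J. real (card (A \<inter> dyadic j)) * exp (- level_cost M j))"
    using assms by (subst sum.swap) (simp add: sum.If_cases Collect_mem_eq Int_def)
  also have "\<dots> = real (card (A \<inter> {0, 1})) + (\<Sum>i<J. real (card (A \<inter> dyadic (Suc i))) * exp (- level_cost M (Suc i)))"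
    by (subst sum.atMost_shift) (simp add: level_cost_def)
  also have "(\<Sum>i<J. real (card (A \<inter> dyadic (Suc i))) * exp (- level_cost M (Suc i))) \<le> (\<Sum>i<J. exp (- M) * (1/2) ^ i)"
    by (rule sum_mono) (rule level)
  also have "(\<Sum>i<J. exp (- M) * (1/2) ^ i) \<le> 2 * exp (- M)"
    by (simp add: sum_distrib_left[symmetric] sum_gp_strict)
  finally show ?thesis by simp
qed

section \<open>Counting words by their mean description length\<close>

text \<open>
  Kraft's inequality combined with Jensen's inequality. A family of words, in each of which every
  letter is a value of some level, has at most as many members as the exponential of its mean
  price, up to the Kraft sums of the alphabets. At the positions in \<open>bd\<close> the alphabet contains both
  free letters \<open>0\<close> and \<open>1\<close>; elsewhere \<open>0\<close> is the only free letter. Hence only the positions in \<open>bd\<close>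
  contribute a factor \<open>2\<close>.
\<close>

lemma card_le_of_level_cost:
  fixes code :: "'e \<Rightarrow> 'i \<Rightarrow> real" and lev :: "'e \<Rightarrow> 'i \<Rightarrow> nat"
  assumes fin: "finite E" "finite I" and bd: "bd \<subseteq> I"
    and lev: "\<And>x i. x \<in> E \<Longrightarrow> i \<in> I \<Longrightarrow> code x i \<in> dyadic (lev x i)"
    and ne1: "\<And>x i. x \<in> E \<Longrightarrow> i \<in> I - bd \<Longrightarrow> code x i \<noteq> 1"
    and inj: "inj_on (\<lambda>x. restrict (code x) I) E"
    and mean: "(\<Sum>x\<in>E. \<Sum>i\<in>I. level_cost M (lev x i)) \<le> m * real (card E)"
  shows "real (card E) \<le> exp m * (1 + 2 * exp (- M)) ^ card I * 2 ^ card bd"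
proof -
  define J where "J = Max (insert 0 ((\<lambda>(x, i). lev x i) ` (E \<times> I)))"
  have J: "lev x i \<le> J" if "x \<in> E" "i \<in> I" for x i
    unfolding J_def using fin that by (intro Max_ge) auto
  define w where "w = (\<lambda>v. \<Sum>j\<le>J. if v \<in> dyadic j then exp (- level_cost M j) else 0)"
  define A where "A = (\<lambda>i. if i \<in> bd then dyadic J else dyadic J - {1})"
  define c where "c = (\<lambda>x. \<Sum>i\<in>I. level_cost M (lev x i))"
  have w_nonneg: "w v \<ge> 0" for v unfolding w_def by (intro sum_nonneg) auto
  have w_ge: "exp (- level_cost M (lev x i)) \<le> w (code x i)" if "x \<in> E" "i \<in> I" for x i
  proof -
    have "exp (- level_cost M (lev x i)) = (\<Sum>j\<in>{lev x i}. if code x i \<in> dyadic j then exp (- level_cost M j) else 0)"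
      using lev[OF that] by simp
    also have "\<dots> \<le> w (code x i)"
      unfolding w_def using J[OF that] by (intro sum_mono2) auto
    finally show ?thesis .
  qed
  have finA: "finite (A i)" for i unfolding A_def by (simp add: finite_dyadic)
  have total: "(\<Sum>v\<in>A i. w v) \<le> (if i \<in> bd then 2 else 1) * (1 + 2 * exp (- M))" for i
  proof -
    have "(\<Sum>v\<in>A i. w v) \<le> real (card (A i \<inter> {0, 1})) + 2 * exp (- M)"
      unfolding w_def by (rule sum_dyadic_weights[OF finA])
    also have "card (A i \<inter> {0, 1}) \<le> (if i \<in> bd then 2 else 1)"
    proof (cases "i \<in> bd")
      case True
      have "card (A i \<inter> {0, 1}) \<le> card {0, 1::real}" by (intro card_mono) auto
      then show ?thesis using True by simp
    next
      case False
      have "card (A i \<inter> {0, 1}) \<le> card {0::real}" using False by (intro card_mono) (auto simp: A_def)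
      then show ?thesis using False by simp
    qed
    then have "real (card (A i \<inter> {0, 1})) \<le> (if i \<in> bd then 2 else 1)"
      by (cases "i \<in> bd") auto
    also have "(if i \<in> bd then 2 else 1) + 2 * exp (- M) \<le> (if i \<in> bd then 2 else 1) * (1 + 2 * exp (- M))"
      by (simp add: distrib_left)
    finally show ?thesis by simp
  qed
  \<comment> \<open>distinct words are distinct points of the product of the alphabets, whose total weight factorises\<close>
  have "(\<Sum>x\<in>E. exp (- c x)) = (\<Sum>x\<in>E. \<Prod>i\<in>I. exp (- level_cost M (lev x i)))"
    unfolding c_def using fin by (simp add: exp_sum sum_negf[symmetric])
  also have "\<dots> \<le> (\<Sum>x\<in>E. \<Prod>i\<in>I. w (code x i))"
    using w_ge by (intro sum_mono prod_mono) auto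
  also have "\<dots> = (\<Sum>g\<in>(\<lambda>x. restrict (code x) I) ` E. \<Prod>i\<in>I. w (g i))"
    by (subst sum.reindex[OF inj]) simp
  also have "\<dots> \<le> (\<Sum>g\<in>Pi\<^sub>E I A. \<Prod>i\<in>I. w (g i))"
  proof (rule sum_mono2)
    show "finite (Pi\<^sub>E I A)" using fin finA by (intro finite_PiE) auto
    have "code x i \<in> A i" if "x \<in> E" "i \<in> I" for x i
    proof -
      have "code x i \<in> dyadic J" using lev[OF that] dyadic_mono[OF J[OF that]] by auto
      then show ?thesis using ne1[of x i] that by (auto simp: A_def)
    qed
    then show "(\<lambda>x. restrict (code x) I) ` E \<subseteq> Pi\<^sub>E I A" by auto
  qed (auto intro!: prod_nonneg w_nonneg)
  also have "\<dots> = (\<Prod>i\<in>I. \<Sum>v\<in>A i. w v)"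
    using fin finA by (intro prod_sum_PiE[symmetric]) auto
  also have "\<dots> \<le> (\<Prod>i\<in>I. (if i \<in> bd then 2 else 1) * (1 + 2 * exp (- M)))"
    using total by (intro prod_mono) (auto intro!: sum_nonneg w_nonneg)
  also have "\<dots> = (1 + 2 * exp (- M)) ^ card I * 2 ^ card bd"
    using fin bd by (simp add: prod.distrib prod.If_cases Int_absorb1 mult.commute)
  finally have upper: "(\<Sum>x\<in>E. exp (- c x)) \<le> (1 + 2 * exp (- M)) ^ card I * 2 ^ card bd" .
  \<comment> \<open>the tangent line of exp at the mean price: this is Jensen's inequality\<close>
  have "real (card E) \<le> (1 + m) * real (card E) - (\<Sum>x\<in>E. c x)"
    using mean unfolding c_def by (simp add: algebra_simps)
  also have "\<dots> = (\<Sum>x\<in>E. 1 + (m - c x))"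
    by (simp add: sum.distrib sum_subtractf algebra_simps)
  also have "\<dots> \<le> (\<Sum>x\<in>E. exp m * exp (- c x))"
    by (intro sum_mono) (simp add: exp_add[symmetric] exp_ge_add_one_self)
  also have "\<dots> \<le> exp m * ((1 + 2 * exp (- M)) ^ card I * 2 ^ card bd)"
    using upper by (simp add: sum_distrib_left[symmetric])
  finally show ?thesis by (simp add: mult.assoc)
qed

section \<open>Random translation of the Cantor function\<close>

lemma nn_integral_cost_affine:
  assumes "R > 0" "M \<ge> 0"
  shows "(\<integral>\<^sup>+\<theta>. cost M ((s - \<theta>) / R) \<partial>lborel) \<le> ennreal (R * (M + 6))"
proof -
  let ?I = "\<integral>\<^sup>+\<theta>. cost M ((s - \<theta>) / R) \<partial>lborel"
  have "(\<integral>\<^sup>+t. cost M t \<partial>lborel) = ennreal (1 / R) * (\<integral>\<^sup>+\<theta>. cost M (s / R + (- 1 / R) * \<theta>) \<partial>lborel)"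
    using assms by (subst nn_integral_real_affine[where c = "- 1 / R" and t = "s / R"]) auto
  also have "(\<lambda>\<theta>. s / R + (- 1 / R) * \<theta>) = (\<lambda>\<theta>. (s - \<theta>) / R)"
    by (auto simp: diff_divide_distrib)
  finally have "ennreal R * (\<integral>\<^sup>+t. cost M t \<partial>lborel) = ennreal R * ennreal (1 / R) * ?I"
    by (simp add: mult.assoc)
  also have "ennreal R * ennreal (1 / R) = 1"
    using assms by (simp add: ennreal_mult[symmetric])
  finally have "?I = ennreal R * (\<integral>\<^sup>+t. cost M t \<partial>lborel)" by simp
  also have "\<dots> \<le> ennreal R * ennreal (M + 6)"
    by (intro mult_left_mono nn_integral_cost assms) simp
  finally show ?thesis using assms by (simp add: ennreal_mult)
qed

text \<open>
  A staircase in a random position. For every finite family of real numbers the mean price of the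
  values of the rescaled and translated Cantor function has integral at most \<open>R * (M + 6)\<close> over all
  translations. By Fatou's lemma one translation, in a prescribed window of length \<open>L\<close>, is cheap
  for infinitely many of countably many such families at once. The price of a small scale \<open>R\<close> is
  small, which is how the choice of \<open>R\<close> makes the mean price negligible.
\<close>

lemma good_shift_exists:
  fixes \<tau> :: "nat \<Rightarrow> 'j \<Rightarrow> real"
  assumes fin: "\<And>n. finite (J n)" "\<And>n. J n \<noteq> {}" and pos: "R > 0" "L > 0" "M \<ge> 0"
  obtains \<theta> where "a \<le> \<theta>" "\<theta> \<le> a + L"
    "\<exists>\<^sub>F n in sequentially. (\<Sum>i\<in>J n. cost M ((\<tau> n i - \<theta>) / R)) \<le> ennreal (2 * R * (M + 6) / L * real (card (J n)))"
proof -
  define c where "c = 2 * R * (M + 6) / L"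
  have c: "c > 0" using pos by (simp add: c_def)
  \<comment> \<open>h n is the mean price over the n-th family, and c / 2 bounds its average over the window\<close>
  define h where "h = (\<lambda>n \<theta>. ennreal (1 / real (card (J n))) * (\<Sum>i\<in>J n. cost M ((\<tau> n i - \<theta>) / R)))"
  have card: "card (J n) > 0" for n using fin by (simp add: card_gt_0_iff)
  have [measurable]: "h n \<in> borel_measurable borel" for n unfolding h_def by measurable
  have int: "(\<integral>\<^sup>+\<theta>. h n \<theta> * indicator {a..a+L} \<theta> \<partial>lborel) \<le> ennreal (R * (M + 6))" for n
  proof -
    have "(\<integral>\<^sup>+\<theta>. h n \<theta> * indicator {a..a+L} \<theta> \<partial>lborel) \<le> (\<integral>\<^sup>+\<theta>. h n \<theta> \<partial>lborel)"
      by (intro nn_integral_mono) (auto simp: indicator_def)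
    also have "\<dots> = ennreal (1 / real (card (J n))) * (\<Sum>i\<in>J n. \<integral>\<^sup>+\<theta>. cost M ((\<tau> n i - \<theta>) / R) \<partial>lborel)"
      unfolding h_def by (subst nn_integral_cmult, measurable, subst nn_integral_sum) auto
    also have "\<dots> \<le> ennreal (1 / real (card (J n))) * (\<Sum>i\<in>J n. ennreal (R * (M + 6)))"
      by (intro mult_left_mono sum_mono nn_integral_cost_affine pos) simp
    also have "\<dots> = ennreal (1 / real (card (J n)) * (real (card (J n)) * (R * (M + 6))))"
      using pos by (subst sum_ennreal) (auto simp: ennreal_mult[symmetric])
    also have "\<dots> = ennreal (R * (M + 6))" using card[of n] by simp
    finally show ?thesis .
  qed
  have "\<exists>\<theta>\<in>{a..a+L}. \<exists>\<^sub>F n in sequentially. h n \<theta> \<le> ennreal c"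
  proof (rule ccontr)
    assume none: "\<not> (\<exists>\<theta>\<in>{a..a+L}. \<exists>\<^sub>F n in sequentially. h n \<theta> \<le> ennreal c)"
    have ev: "\<forall>\<^sub>F n in sequentially. ennreal c \<le> h n \<theta>" if "\<theta> \<in> {a..a+L}" for \<theta>
    proof -
      have "\<forall>\<^sub>F n in sequentially. \<not> h n \<theta> \<le> ennreal c"
        using none that unfolding frequently_def by blast
      then show ?thesis by (rule eventually_mono) simp
    qed
    have "ennreal (c * L) = (\<integral>\<^sup>+\<theta>. ennreal c * indicator {a..a+L} \<theta> \<partial>lborel)"
      using c pos by (subst nn_integral_cmult_indicator) (auto simp: ennreal_mult[symmetric])
    also have "\<dots> \<le> (\<integral>\<^sup>+\<theta>. liminf (\<lambda>n. h n \<theta> * indicator {a..a+L} \<theta>) \<partial>lborel)"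
    proof (rule nn_integral_mono)
      fix \<theta> :: real
      show "ennreal c * indicator {a..a+L} \<theta> \<le> liminf (\<lambda>n. h n \<theta> * indicator {a..a+L} \<theta>)"
      proof (cases "\<theta> \<in> {a..a+L}")
        case True
        then show ?thesis using ev[OF True] by (intro Liminf_bounded) auto
      qed auto
    qed
    also have "\<dots> \<le> liminf (\<lambda>n. \<integral>\<^sup>+\<theta>. h n \<theta> * indicator {a..a+L} \<theta> \<partial>lborel)"
      by (intro nn_integral_liminf) measurable
    also have "\<dots> \<le> ennreal (R * (M + 6))"
      by (rule order_trans[OF Liminf_le_Limsup Limsup_bounded]) (auto simp: int)
    finally have "c * L \<le> R * (M + 6)" using pos by (simp add: ennreal_le_iff)
    moreover have "c * L = 2 * (R * (M + 6))" using pos by (simp add: c_def)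
    moreover have "R * (M + 6) > 0" using pos by simp
    ultimately show False by linarith
  qed
  then obtain \<theta> where \<theta>: "\<theta> \<in> {a..a+L}" "\<exists>\<^sub>F n in sequentially. h n \<theta> \<le> ennreal c" by blast
  have "(\<Sum>i\<in>J n. cost M ((\<tau> n i - \<theta>) / R)) \<le> ennreal (c * real (card (J n)))" if "h n \<theta> \<le> ennreal c" for n
  proof -
    let ?S = "\<Sum>i\<in>J n. cost M ((\<tau> n i - \<theta>) / R)"
    have "ennreal (real (card (J n))) * h n \<theta> \<le> ennreal (real (card (J n))) * ennreal c"
      by (intro mult_left_mono that) simp
    moreover have "ennreal (real (card (J n))) * ennreal (1 / real (card (J n))) = 1"
      using card[of n] by (subst ennreal_mult[symmetric]) auto
    ultimately show ?thesis
      using c unfolding h_def by (simp add: mult.assoc[symmetric] ennreal_mult[symmetric] mult.commute)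
  qed
  then have "\<exists>\<^sub>F n in sequentially. (\<Sum>i\<in>J n. cost M ((\<tau> n i - \<theta>) / R)) \<le> ennreal (c * real (card (J n)))"
    by (rule frequently_elim1[OF \<theta>(2)])
  then show thesis
    using \<theta>(1) unfolding c_def by (intro that) auto
qed

section \<open>Finite prediction\<close>

text \<open>
  Approximate a member of the closed algebra by a polynomial in finitely many generators. Exact
  agreement of these generators at two points forces exact agreement of the polynomial, hence
  approximate agreement of the given function. In the induction, boundedness is carried along to
  deal with products.
\<close>

lemma closed_algebra_finitely_determined:
  assumes "f \<in> closed_algebra X F"
    and "\<And>g. g \<in> F \<Longrightarrow> \<exists>B. \<forall>x\<in>X. \<bar>g x\<bar> \<le> B"
    and "e > 0"
  shows "\<exists>G\<subseteq>F. finite G \<and> (\<forall>x\<in>X. \<forall>y\<in>X. (\<forall>g\<in>G. g x = g y) \<longrightarrow> \<bar>f x - f y\<bar> < e)"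
proof -
  define determined where "determined = (\<lambda>f e. \<exists>G\<subseteq>F. finite G \<and>
    (\<forall>x\<in>X. \<forall>y\<in>X. (\<forall>g\<in>G. g x = g y) \<longrightarrow> \<bar>f x - f y\<bar> < (e::real)))"
  have joint: "determined h e" if "determined f a" "determined g b"
    and that0: "\<And>x y. x \<in> X \<Longrightarrow> y \<in> X \<Longrightarrow> \<bar>f x - f y\<bar> < a \<Longrightarrow> \<bar>g x - g y\<bar> < b \<Longrightarrow> \<bar>h x - h y\<bar> < e"
    for f g h a b e
  proof -
    from that(1) obtain G1 where G1: "G1 \<subseteq> F \<and> finite G1 \<and>
        (\<forall>x\<in>X. \<forall>y\<in>X. (\<forall>k\<in>G1. k x = k y) \<longrightarrow> \<bar>f x - f y\<bar> < a)"
      unfolding determined_def ..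
    from that(2) obtain G2 where G2: "G2 \<subseteq> F \<and> finite G2 \<and>
        (\<forall>x\<in>X. \<forall>y\<in>X. (\<forall>k\<in>G2. k x = k y) \<longrightarrow> \<bar>g x - g y\<bar> < b)"
      unfolding determined_def ..
    have "\<bar>h x - h y\<bar> < e" if xy: "x \<in> X" "y \<in> X" "\<forall>k\<in>G1 \<union> G2. k x = k y" for x y
    proof (rule that0[OF xy(1,2)])
      show "\<bar>f x - f y\<bar> < a" using G1 xy by simp
      show "\<bar>g x - g y\<bar> < b" using G2 xy by simp
    qed
    with G1 G2 show ?thesis
      unfolding determined_def by (intro exI[of _ "G1 \<union> G2"] conjI ballI impI) simp_all
  qed
  have "(\<exists>B. \<forall>x\<in>X. \<bar>f x\<bar> \<le> B) \<and> (\<forall>e>0. determined f e)"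
    using assms(1)
  proof induction
    case zero
    then show ?case unfolding determined_def by auto
  next
    case (gen f)
    then show ?case using assms(2) unfolding determined_def by (auto intro!: exI[of _ "{f}"])
  next
    case (add f g)
    then obtain B C where "\<forall>x\<in>X. \<bar>f x\<bar> \<le> B" "\<forall>x\<in>X. \<bar>g x\<bar> \<le> C" by blast
    then have "\<forall>x\<in>X. \<bar>f x + g x\<bar> \<le> B + C" by fastforce
    moreover have "determined (\<lambda>x. f x + g x) e" if "e > 0" for e
    proof (rule joint[where f = f and g = g and a = "e/2" and b = "e/2"])
      show "determined f (e/2)" "determined g (e/2)" using add that by auto
      show "\<bar>f x + g x - (f y + g y)\<bar> < e" if "\<bar>f x - f y\<bar> < e/2" "\<bar>g x - g y\<bar> < e/2" for x y
        using that unfolding abs_less_iff by argo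
    qed
    ultimately show ?case by blast
  next
    case (mult f g)
    then obtain B0 C0 where BC0: "\<forall>x\<in>X. \<bar>f x\<bar> \<le> B0" "\<forall>x\<in>X. \<bar>g x\<bar> \<le> C0" by blast
    define B C where "B = \<bar>B0\<bar> + 1" and "C = \<bar>C0\<bar> + 1"
    have BC: "\<bar>f x\<bar> \<le> B" "\<bar>g x\<bar> \<le> C" if "x \<in> X" for x
      using BC0 that unfolding B_def C_def by fastforce+
    have pos: "B > 0" "C > 0" unfolding B_def C_def by auto
    have "\<forall>x\<in>X. \<bar>f x * g x\<bar> \<le> B * C"
      using BC pos by (auto simp: abs_mult intro!: mult_mono)
    moreover have "determined (\<lambda>x. f x * g x) e" if "e > 0" for e
    proof (rule joint[where f = f and g = g and a = "e/(2*C)" and b = "e/(2*B)"])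
      show "determined f (e / (2 * C))" "determined g (e / (2 * B))" using mult that pos by auto
      fix x y assume xy: "x \<in> X" "y \<in> X" "\<bar>f x - f y\<bar> < e / (2 * C)" "\<bar>g x - g y\<bar> < e / (2 * B)"
      have "\<bar>f x * g x - f y * g y\<bar> = \<bar>f x * (g x - g y) + g y * (f x - f y)\<bar>"
        by (simp add: algebra_simps)
      also have "\<dots> \<le> \<bar>f x\<bar> * \<bar>g x - g y\<bar> + \<bar>g y\<bar> * \<bar>f x - f y\<bar>"
        by (metis abs_mult abs_triangle_ineq)
      also have "\<dots> \<le> B * \<bar>g x - g y\<bar> + C * \<bar>f x - f y\<bar>"
        using BC xy by (intro add_mono mult_right_mono) auto
      also have "\<dots> < B * (e / (2 * B)) + C * (e / (2 * C))"
        using xy pos by (intro add_strict_mono mult_strict_left_mono) auto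
      also have "\<dots> = e" using pos by simp
      finally show "\<bar>f x * g x - f y * g y\<bar> < e" .
    qed
    ultimately show ?case by blast
  next
    case (scale f c)
    then obtain B where B: "\<forall>x\<in>X. \<bar>f x\<bar> \<le> B" by blast
    have "\<forall>x\<in>X. \<bar>c * f x\<bar> \<le> \<bar>c\<bar> * B"
      using B by (auto simp: abs_mult intro!: mult_left_mono)
    moreover have "determined (\<lambda>x. c * f x) e" if "e > 0" for e
    proof (rule joint[where f = f and g = f and a = "e/(\<bar>c\<bar> + 1)" and b = "e/(\<bar>c\<bar> + 1)"])
      show "determined f (e / (\<bar>c\<bar> + 1))" "determined f (e / (\<bar>c\<bar> + 1))" using scale that by (auto simp: add_nonneg_pos)
      fix x y assume "\<bar>f x - f y\<bar> < e / (\<bar>c\<bar> + 1)"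
      then have "(\<bar>c\<bar> + 1) * \<bar>f x - f y\<bar> < e" by (simp add: pos_less_divide_eq add_nonneg_pos mult.commute)
      moreover have "\<bar>c * f x - c * f y\<bar> = \<bar>c\<bar> * \<bar>f x - f y\<bar>"
        by (simp add: abs_mult[symmetric] algebra_simps)
      ultimately show "\<bar>c * f x - c * f y\<bar> < e" by (simp add: algebra_simps)
    qed
    ultimately show ?case by blast
  next
    case (limit g f)
    have near: "\<exists>n. \<forall>x\<in>X. \<bar>g n x - f x\<bar> < e" if "e > 0" for e
    proof -
      have "\<forall>\<^sub>F n in sequentially. \<forall>x\<in>X. dist (g n x) (f x) < e"
        by (rule uniform_limitD[OF limit(2) that])
      then show ?thesis unfolding dist_real_def by (rule eventually_happens'[rotated]) simp
    qed
    obtain n where n: "\<forall>x\<in>X. \<bar>g n x - f x\<bar> < 1" using near[of 1] by auto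
    obtain B where "\<forall>x\<in>X. \<bar>g n x\<bar> \<le> B" using limit.IH by blast
    with n have "\<forall>x\<in>X. \<bar>f x\<bar> \<le> B + 1" by fastforce
    moreover have "determined f e" if epos: "e > 0" for e
    proof -
      obtain n where n: "\<forall>x\<in>X. \<bar>g n x - f x\<bar> < e/3" using near[of "e/3"] epos by auto
      have d: "determined (g n) (e/3)" using limit.IH epos by auto
      show ?thesis
      proof (rule joint[OF d d])
        fix x y assume "x \<in> X" "y \<in> X" "\<bar>g n x - g n y\<bar> < e/3"
        then show "\<bar>f x - f y\<bar> < e" using n[rule_format, of x] n[rule_format, of y]
          unfolding abs_less_iff by argo
      qed
    qed
    ultimately show ?case by blast
  qed
  then have "determined f e" using assms(3) by simp
  then show ?thesis unfolding determined_def .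
qed

text \<open>
  The form in which predictability is used: up to an error \<open>e\<close>, the present value of \<open>f\<close> is determined
  by its exact values at finitely many past times.
\<close>

lemma predictable_finite_past:
  fixes T :: "int ^ 'n::{finite,linorder} \<Rightarrow> 'a::metric_space \<Rightarrow> 'a"
  assumes "compact X" and tp: "topologically_predictable X T"
    and maps: "\<And>u x. x \<in> X \<Longrightarrow> T u x \<in> X" and "continuous_on X (f :: 'a \<Rightarrow> real)" and "e > 0"
  shows "\<exists>K. finite K \<and> (\<forall>v\<in>K. lex_less v 0) \<and>
    (\<forall>x\<in>X. \<forall>y\<in>X. (\<forall>v\<in>K. f (T v x) = f (T v y)) \<longrightarrow> \<bar>f x - f y\<bar> < e)"
proof -
  let ?F = "insert (\<lambda>_. 1) {f \<circ> T u | u. lex_less u 0}"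
  have mem: "f \<in> closed_algebra X ?F"
    using tp \<open>continuous_on X f\<close> unfolding topologically_predictable_def by blast
  have "bounded (f ` X)"
    by (intro compact_imp_bounded compact_continuous_image assms)
  then obtain C where C: "\<And>x. x \<in> X \<Longrightarrow> \<bar>f x\<bar> \<le> C"
    unfolding bounded_iff by auto
  have bdd: "\<exists>B. \<forall>x\<in>X. \<bar>g x\<bar> \<le> B" if "g \<in> ?F" for g
  proof (rule exI[of _ "max 1 C"], rule ballI)
    fix x assume "x \<in> X"
    show "\<bar>g x\<bar> \<le> max 1 C"
      using that
    proof (elim insertE CollectE exE conjE)
      fix u assume "g = f \<circ> T u"
      then show ?thesis using C[OF maps[OF \<open>x \<in> X\<close>], of u] by simp
    qed simp
  qed
  from closed_algebra_finitely_determined[OF mem bdd \<open>e > 0\<close>]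
  obtain G where G: "G \<subseteq> ?F \<and> finite G \<and>
    (\<forall>x\<in>X. \<forall>y\<in>X. (\<forall>g\<in>G. g x = g y) \<longrightarrow> \<bar>f x - f y\<bar> < e)" ..
  have "G - {\<lambda>_. 1} \<subseteq> (\<lambda>u. f \<circ> T u) ` {u. lex_less u 0}" "finite (G - {\<lambda>_. 1})"
    using G by auto
  then obtain K where K: "K \<subseteq> {u. lex_less u 0}" "finite K" "G - {\<lambda>_. 1} = (\<lambda>u. f \<circ> T u) ` K"
    by (metis finite_subset_image)
  have "\<bar>f x - f y\<bar> < e" if xy: "x \<in> X" "y \<in> X" and eq: "\<forall>v\<in>K. f (T v x) = f (T v y)" for x y
  proof -
    have "g x = g y" if "g \<in> G" for g
    proof (cases "g = (\<lambda>_. 1)")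
      case False
      then have "g \<in> (\<lambda>u. f \<circ> T u) ` K" using that K(3) by blast
      then show ?thesis using eq by auto
    qed simp
    then show ?thesis using G xy by simp
  qed
  then show ?thesis using K(1,2) by blast
qed

section \<open>Boxes and the lexicographic order\<close>

lemma box_Zd_eq_PiE: "vec_nth ` (box_Zd n :: (int ^ 'n::finite) set) = Pi\<^sub>E UNIV (\<lambda>_. {0..<int n})"
proof (intro set_eqI iffI)
  fix f :: "'n \<Rightarrow> int" assume "f \<in> Pi\<^sub>E UNIV (\<lambda>_. {0..<int n})"
  then have "vec_lambda f \<in> box_Zd n" unfolding box_Zd_def by (auto simp: PiE_iff)
  then show "f \<in> vec_nth ` (box_Zd n :: (int ^ 'n::finite) set)"
    by (intro image_eqI[of _ _ "vec_lambda f"]) (auto simp: vec_lambda_inverse)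
qed (auto simp: box_Zd_def)

lemma finite_box_Zd: "finite (box_Zd n :: (int ^ 'n::finite) set)"
  and card_box_Zd: "card (box_Zd n :: (int ^ 'n::finite) set) = n ^ CARD('n)"
proof -
  have inj: "inj_on vec_nth (box_Zd n :: (int ^ 'n::finite) set)"
    by (auto simp: inj_on_def vec_eq_iff)
  show "finite (box_Zd n :: (int ^ 'n::finite) set)"
    using inj by (rule finite_imageD[rotated]) (simp add: box_Zd_eq_PiE finite_PiE)
  show "card (box_Zd n :: (int ^ 'n::finite) set) = n ^ CARD('n)"
    using card_image[OF inj] by (simp add: box_Zd_eq_PiE card_PiE)
qed

text \<open>
  Boxes form a Folner sequence: the points of the box of side \<open>n\<close> from which a fixed finite set of
  steps can leave the box miss the concentric box of side \<open>n - 2 * m\<close>, where \<open>m\<close> bounds the steps.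
\<close>

lemma box_Zd_boundary:
  fixes K :: "(int ^ 'n::finite) set"
  assumes "finite K" "e > 0"
  shows "\<forall>\<^sub>F n in sequentially.
    real (card {u \<in> box_Zd n. \<exists>v\<in>K. u + v \<notin> box_Zd n}) \<le> e * real n ^ CARD('n)"
proof -
  obtain m :: nat where m: "\<And>v i. v \<in> K \<Longrightarrow> \<bar>v $ i\<bar> \<le> int m"
  proof -
    let ?S = "(\<lambda>(v, i). nat \<bar>v $ i\<bar>) ` (K \<times> UNIV)"
    have "\<bar>v $ i\<bar> \<le> int (Max ?S)" if "v \<in> K" for v i
    proof -
      have "nat \<bar>v $ i\<bar> \<le> Max ?S" using assms(1) that by (intro Max_ge) auto
      then show ?thesis by linarith
    qed
    then show thesis using that by blast
  qed
  have le: "real (card {u \<in> box_Zd n. \<exists>v\<in>K. u + v \<notin> box_Zd n}) \<le> real n ^ CARD('n) - real (n - 2 * m) ^ CARD('n)"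
    if "n \<ge> 2 * m" for n
  proof -
    let ?B = "box_Zd n :: (int ^ 'n) set" and ?I = "(\<lambda>u. u + (\<chi> i. int m)) ` (box_Zd (n - 2 * m) :: (int ^ 'n) set)"
    have I: "?I \<subseteq> ?B"
    proof (rule image_subsetI)
      fix w assume "w \<in> (box_Zd (n - 2 * m) :: (int ^ 'n) set)"
      then have *: "0 \<le> w $ i" "w $ i < int (n - 2 * m)" for i by (auto simp: box_Zd_def)
      show "w + (\<chi> i. int m) \<in> ?B"
        unfolding box_Zd_def
      proof (intro CollectI allI)
        show "0 \<le> (w + (\<chi> i. int m)) $ i \<and> (w + (\<chi> i. int m)) $ i < int n" for i
          using *[of i] that by (simp add: of_nat_diff)
      qed
    qed
    have "{u \<in> ?B. \<exists>v\<in>K. u + v \<notin> ?B} \<subseteq> ?B - ?I"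
    proof clarify
      fix w v assume "v \<in> K" "w \<in> (box_Zd (n - 2 * m) :: (int ^ 'n) set)"
        and out: "w + (\<chi> i. int m) + v \<notin> ?B"
      have "0 \<le> (w + (\<chi> i. int m) + v) $ i \<and> (w + (\<chi> i. int m) + v) $ i < int n" for i
      proof -
        have "0 \<le> w $ i" "w $ i < int (n - 2 * m)"
          using \<open>w \<in> _\<close> unfolding box_Zd_def by auto
        then show ?thesis using m[OF \<open>v \<in> K\<close>, of i] that by (simp add: of_nat_diff abs_le_iff)
      qed
      then show False using out unfolding box_Zd_def by blast
    qed
    then have "card {u \<in> ?B. \<exists>v\<in>K. u + v \<notin> ?B} \<le> card (?B - ?I)"
      by (intro card_mono) (auto simp: finite_box_Zd)
    also have "\<dots> = card ?B - card ?I"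
      using I by (intro card_Diff_subset) (auto intro: finite_subset finite_box_Zd)
    also have "card ?I = (n - 2 * m) ^ CARD('n)"
      by (subst card_image) (auto simp: card_box_Zd inj_on_def)
    finally have "card {u \<in> ?B. \<exists>v\<in>K. u + v \<notin> ?B} \<le> n ^ CARD('n) - (n - 2 * m) ^ CARD('n)"
      by (simp add: card_box_Zd)
    then have "real (card {u \<in> ?B. \<exists>v\<in>K. u + v \<notin> ?B}) \<le> real (n ^ CARD('n) - (n - 2 * m) ^ CARD('n))"
      by (rule of_nat_mono)
    also have "\<dots> = real n ^ CARD('n) - real (n - 2 * m) ^ CARD('n)"
      by (subst of_nat_diff) (auto intro: power_mono)
    finally show ?thesis .
  qed
  have "(\<lambda>n. 1 - 2 * real m * inverse (real n)) \<longlonglongrightarrow> 1 - 2 * real m * 0"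
    by (intro tendsto_intros lim_inverse_n)
  then have "(\<lambda>n. (1 - 2 * real m * inverse (real n)) ^ CARD('n)) \<longlonglongrightarrow> 1 ^ CARD('n)"
    by (intro tendsto_power) simp
  then have "\<forall>\<^sub>F n in sequentially. 1 - e < (1 - 2 * real m * inverse (real n)) ^ CARD('n)"
    by (rule order_tendstoD) (use assms(2) in simp)
  moreover have "\<forall>\<^sub>F n in sequentially. n \<ge> 2 * m + 1"
    by (rule eventually_ge_at_top)
  ultimately show ?thesis
  proof eventually_elim
    case (elim n)
    have "1 - 2 * real m * inverse (real n) = real (n - 2 * m) / real n"
      using elim(2) by (simp add: of_nat_diff field_simps)
    then have "(1 - e) * real n ^ CARD('n) \<le> real (n - 2 * m) ^ CARD('n)"
      using elim by (simp add: power_divide pos_less_divide_eq)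
    with le[of n] elim(2) show ?case by (simp add: algebra_simps)
  qed
qed

lemma lex_less_add: "lex_less v 0 \<Longrightarrow> lex_less (u + v) u"
  unfolding lex_less_def by auto

lemma lex_less_irrefl: "\<not> lex_less u u"
  unfolding lex_less_def by auto

lemma lex_less_trans: "lex_less u v \<Longrightarrow> lex_less v w \<Longrightarrow> lex_less u w"
  unfolding lex_less_def
proof (elim exE conjE)
  fix i k assume *: "\<forall>j<i. u $ j = v $ j" "u $ i < v $ i" "\<forall>j<k. v $ j = w $ j" "v $ k < w $ k"
  show "\<exists>i. (\<forall>j<i. u $ j = w $ j) \<and> u $ i < w $ i"
    using * by (intro exI[of _ "min i k"]) (cases i k rule: linorder_cases; auto)
qed

text \<open>
  Through this lemma a strong induction along the lexicographic order, which is not well-founded on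
  the whole lattice, becomes available in finite sets of sites.
\<close>

lemma finite_lex_minimal:
  assumes "finite S" "S \<noteq> {}"
  obtains u where "u \<in> S" "\<And>v. lex_less v u \<Longrightarrow> v \<notin> S"
proof -
  let ?r = "{(v, u). v \<in> S \<and> u \<in> S \<and> lex_less v u}"
  have "wf ?r"
  proof (rule finite_acyclic_wf)
    show "finite ?r" using assms(1) by (rule_tac finite_subset[of _ "S \<times> S"]) auto
    have "trans ?r" by (auto intro!: transI intro: lex_less_trans)
    then show "acyclic ?r" unfolding acyclic_def by (simp add: lex_less_irrefl)
  qed
  then obtain u where u: "u \<in> S" "\<And>v. (v, u) \<in> ?r \<Longrightarrow> v \<notin> S"
    using assms(2) by (rule wfE_min') blast
  show thesis
  proof (rule that[OF u(1)])
    fix v assume less: "lex_less v u"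
    show "v \<notin> S"
    proof
      assume "v \<in> S"
      with less u(1) have "(v, u) \<in> ?r" by simp
      from u(2)[OF this] \<open>v \<in> S\<close> show False by blast
    qed
  qed
qed

section \<open>Separated sets and covering numbers\<close>

lemma open_cover_Lebesgue_number:
  assumes "compact X" and cover: "open_cover X \<U>"
  obtains e where "e > 0" "\<And>x. x \<in> X \<Longrightarrow> \<exists>G\<in>\<U>. ball x e \<inter> X \<subseteq> G"
proof -
  let ?W = "{W. open W \<and> X \<inter> W \<in> \<U>}"
  have sub: "X \<subseteq> \<Union>?W"
  proof
    fix x assume "x \<in> X"
    then obtain A where "A \<in> \<U>" "x \<in> A" "openin (top_of_set X) A"
      using cover unfolding open_cover_def by blast
    then obtain W where "open W" "A = X \<inter> W" by (auto simp: openin_open)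
    then show "x \<in> \<Union>?W" using \<open>A \<in> \<U>\<close> \<open>x \<in> A\<close> by auto
  qed
  from sub obtain e where "e > 0" and e: "\<And>x. x \<in> X \<Longrightarrow> \<exists>G\<in>?W. ball x e \<subseteq> G"
    by (rule Heine_Borel_lemma[OF \<open>compact X\<close>]) auto
  have "\<exists>G\<in>\<U>. ball x e \<inter> X \<subseteq> G" if "x \<in> X" for x
    using e[OF that] by blast
  with \<open>e > 0\<close> show thesis by (rule that)
qed

text \<open>
  As long as fewer points than the covering number are chosen, the members of the join around the
  chosen points fail to cover the space, and any point left over is separated from all of them.
\<close>

lemma separated_set_exists:
  fixes T :: "int ^ 'n::finite \<Rightarrow> 'a::metric_space \<Rightarrow> 'a"
  assumes lebesgue: "\<And>x. x \<in> X \<Longrightarrow> \<exists>G\<in>\<U>. ball x e \<inter> X \<subseteq> G"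
    and maps: "\<And>u x. x \<in> X \<Longrightarrow> T u x \<in> X"
    and "e > 0" and "j \<le> cover_number X (cover_join X T \<U> K)"
  shows "\<exists>E\<subseteq>X. finite E \<and> card E = j \<and> (\<forall>x\<in>E. \<forall>y\<in>E. x \<noteq> y \<longrightarrow> (\<exists>u\<in>K. e \<le> dist (T u x) (T u y)))"
  using assms(4)
proof (induction j)
  case 0
  show ?case by (rule exI[of _ "{}"]) auto
next
  case (Suc j)
  then obtain E where E: "E \<subseteq> X" "finite E" "card E = j"
    "\<And>x y. x \<in> E \<Longrightarrow> y \<in> E \<Longrightarrow> x \<noteq> y \<Longrightarrow> \<exists>u\<in>K. e \<le> dist (T u x) (T u y)"
    by (metis Suc_leD)
  obtain G where G: "\<And>x. x \<in> X \<Longrightarrow> G x \<in> \<U>" "\<And>x. x \<in> X \<Longrightarrow> ball x e \<inter> X \<subseteq> G x"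
    using lebesgue by metis
  define A where "A = (\<lambda>x. {z\<in>X. \<forall>u\<in>K. T u z \<in> G (T u x)})"
  have join: "A ` E \<subseteq> cover_join X T \<U> K"
  proof (intro image_subsetI)
    fix x assume "x \<in> E"
    then have "\<forall>u\<in>K. G (T u x) \<in> \<U>" using E(1) maps G(1) by auto
    then show "A x \<in> cover_join X T \<U> K"
      unfolding cover_join_def A_def
      by (intro CollectI exI[of _ "\<lambda>u. G (T u x)"]) simp
  qed
  have "\<not> X \<subseteq> \<Union>(A ` E)"
  proof
    assume "X \<subseteq> \<Union>(A ` E)"
    with join E(2) have "cover_number X (cover_join X T \<U> K) \<le> card (A ` E)"
      unfolding cover_number_def by (intro Least_le) blast
    also have "\<dots> \<le> j" using card_image_le[OF E(2)] E(3) by auto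
    finally show False using Suc.prems by simp
  qed
  then obtain z where z: "z \<in> X" "\<And>x. x \<in> E \<Longrightarrow> z \<notin> A x" by blast
  have far: "\<exists>u\<in>K. e \<le> dist (T u x) (T u z)" if xE: "x \<in> E" for x
  proof -
    obtain u where u: "u \<in> K" "T u z \<notin> G (T u x)"
      using z(1) z(2)[OF xE] unfolding A_def by blast
    then have "T u z \<notin> ball (T u x) e" using G(2)[of "T u x"] maps z(1) E(1) xE by blast
    then show ?thesis using u by (auto simp: not_less)
  qed
  have "z \<notin> E" using far[of z] \<open>e > 0\<close> by auto
  show ?case
  proof (intro exI[of _ "insert z E"] conjI ballI impI)
    show "insert z E \<subseteq> X" "finite (insert z E)" "card (insert z E) = Suc j"
      using E(1-3) z(1) \<open>z \<notin> E\<close> by simp_all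
    fix x y assume xy: "x \<in> insert z E" "y \<in> insert z E" "x \<noteq> y"
    then consider "x \<in> E" "y \<in> E" | "x \<in> E" "y = z" | "x = z" "y \<in> E" by blast
    then show "\<exists>u\<in>K. e \<le> dist (T u x) (T u y)"
      by cases (use E(4)[of x y] far[of x] far[of y] xy(3) in \<open>simp_all add: dist_commute\<close>)
  qed
qed

section \<open>Names of orbits of a predictable action\<close>

text \<open>
  The coding argument. A name of a point records the values of finitely many functions \<open>F p\<close> along a
  finite piece \<open>B\<close> of the orbit. At a site whose \<open>K\<close>-past lies inside \<open>B\<close>, the value \<open>1\<close> is recorded as
  \<open>0\<close>. Nothing is lost by that: going through the sites in lexicographic order, the past of such a
  site has been recovered already, it determines the value up to an error less than \<open>1\<close>, and
  this is enough to tell \<open>0\<close> from \<open>1\<close>. So all free letters at these sites coincide, and only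
  the expensive letters and the sites near the boundary of \<open>B\<close> carry information.
\<close>

lemma card_le_of_predictable_codes:
  fixes T :: "int ^ 'n::{finite,linorder} \<Rightarrow> 'a \<Rightarrow> 'a" and F :: "'p \<Rightarrow> 'a \<Rightarrow> real"
  assumes fin: "finite E" "finite P" "finite B"
    and past: "\<And>v. v \<in> K \<Longrightarrow> lex_less v 0"
    and "E \<subseteq> X" and maps: "\<And>u x. x \<in> X \<Longrightarrow> T u x \<in> X"
    and act: "\<And>u v x. x \<in> X \<Longrightarrow> T (u + v) x = T u (T v x)"
    and pred: "\<And>p x y. p \<in> P \<Longrightarrow> x \<in> X \<Longrightarrow> y \<in> X \<Longrightarrow>
       \<forall>v\<in>K. F p (T v x) = F p (T v y) \<Longrightarrow> \<bar>F p x - F p y\<bar> < 1"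
    and lev: "\<And>x p u. x \<in> E \<Longrightarrow> p \<in> P \<Longrightarrow> u \<in> B \<Longrightarrow> F p (T u x) \<in> dyadic (lev x (p, u))"
    and mean: "(\<Sum>x\<in>E. \<Sum>i\<in>P \<times> B. level_cost M (lev x i)) \<le> m * real (card E)"
    and sep: "\<And>x y. x \<in> E \<Longrightarrow> y \<in> E \<Longrightarrow> x \<noteq> y \<Longrightarrow> \<exists>p\<in>P. \<exists>u\<in>B. F p (T u x) \<noteq> F p (T u y)"
  shows "real (card E) \<le> exp m * (1 + 2 * exp (- M)) ^ (card P * card B)
           * 2 ^ (card P * card {u \<in> B. \<exists>v\<in>K. u + v \<notin> B})"
proof -
  define D where "D = {u \<in> B. \<exists>v\<in>K. u + v \<notin> B}"
  define code where "code = (\<lambda>x (p, u). let a = F p (T u x) in if u \<notin> D \<and> a = 1 then 0 else a)"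
  have zero: "0 \<in> dyadic j" for j using dyadic_mono[of 0 j] by auto
  have "real (card E) \<le> exp m * (1 + 2 * exp (- M)) ^ card (P \<times> B) * 2 ^ card (P \<times> D)"
  proof (rule card_le_of_level_cost[where code = code and lev = lev, OF fin(1) _ _ _ _ _ mean])
    show "finite (P \<times> B)" using fin by simp
    show "P \<times> D \<subseteq> P \<times> B" unfolding D_def by auto
    show "code x i \<in> dyadic (lev x i)" if "x \<in> E" "i \<in> P \<times> B" for x i
      using lev[OF that(1), of "fst i" "snd i"] that zero by (auto simp: code_def Let_def)
    show "code x i \<noteq> 1" if "x \<in> E" "i \<in> P \<times> B - P \<times> D" for x i
      using that by (auto simp: code_def Let_def split: if_splits)
    show "inj_on (\<lambda>x. restrict (code x) (P \<times> B)) E"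
    proof (rule inj_onI, rule ccontr)
      fix x y assume xy: "x \<in> E" "y \<in> E" "x \<noteq> y"
        and eq: "restrict (code x) (P \<times> B) = restrict (code y) (P \<times> B)"
      have code_eq: "code x (p, u) = code y (p, u)" if "p \<in> P" "u \<in> B" for p u
        using fun_cong[OF eq, of "(p, u)"] that by simp
      obtain p u0 where p: "p \<in> P" "u0 \<in> B" "F p (T u0 x) \<noteq> F p (T u0 y)"
        using sep[OF xy] by blast
      \<comment> \<open>at the first site where the two orbits have different values of \<open>F p\<close>, all earlier values agree\<close>
      define S where "S = {u \<in> B. F p (T u x) \<noteq> F p (T u y)}"
      have "finite S" "S \<noteq> {}" using fin p unfolding S_def by auto
      then obtain u where u: "u \<in> S" and min: "\<And>v. lex_less v u \<Longrightarrow> v \<notin> S"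
        by (rule finite_lex_minimal) blast
      have uB: "u \<in> B" and ne: "F p (T u x) \<noteq> F p (T u y)" using u unfolding S_def by auto
      have X: "x \<in> X" "y \<in> X" using xy \<open>E \<subseteq> X\<close> by auto
      show False
      proof (cases "u \<in> D")
        case True
        then show False using code_eq[OF p(1) uB] ne by (simp add: code_def)
      next
        case False
        have "F p (T v (T u x)) = F p (T v (T u y))" if "v \<in> K" for v
        proof -
          have "u + v \<in> B" using False uB that unfolding D_def by blast
          moreover have "u + v \<notin> S" using min lex_less_add past[OF that] by blast
          ultimately have "F p (T (u + v) x) = F p (T (u + v) y)" unfolding S_def by blast
          then show ?thesis using act[of x v u] act[of y v u] X by (simp add: add.commute)
        qed
        then have "\<bar>F p (T u x) - F p (T u y)\<bar> < 1"
          using pred[OF p(1) maps[OF X(1)] maps[OF X(2)]] by blast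
        then show False
          using code_eq[OF p(1) uB] False ne by (auto simp: code_def Let_def split: if_splits)
      qed
    qed
  qed
  then show ?thesis by (simp add: card_cartesian_product D_def)
qed

section \<open>Zero entropy\<close>

text \<open>
  Suppose that the covering numbers \<open>N n\<close> exceed \<open>exp (h * n ^ d)\<close> for infinitely many \<open>n\<close>. The
  functions \<open>F p\<close> are rescaled Cantor functions of the distances to the points \<open>p\<close> of a finite
  net. They are \<open>0\<close> near \<open>p\<close> and \<open>1\<close> away from \<open>p\<close>, so they separate the points of an
  \<open>e\<close>-separated set, and the radius \<open>\<theta>\<close> of the transition is chosen to make the names of these
  points cheap on average. The order of choices matters: the net, \<open>M\<close>, the scale \<open>R\<close> and the radius
  come first; they fix the functions and thereby the finite past \<open>KK\<close>; only then is a large box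
  selected, in which the sites near the boundary are negligible.
\<close>

lemma cover_number_growth:
  fixes X :: "'a::metric_space set"
    and T :: "int ^ 'n::{finite,linorder} \<Rightarrow> 'a \<Rightarrow> 'a"
  assumes "compact X" and act: "homeo_action X T" and tp: "topologically_predictable X T"
    and cover: "open_cover X \<U>" and "h > 0"
  shows "\<forall>\<^sub>F n in sequentially.
    ln (real (cover_number X (cover_join X T \<U> (box_Zd n)))) \<le> h * real n ^ CARD('n)"
proof (rule ccontr)
  define N where "N = (\<lambda>n. cover_number X (cover_join X T \<U> (box_Zd n)))"
  define B where "B = (\<lambda>n. box_Zd n :: (int ^ 'n::{finite,linorder}) set)"
  assume not_ev: "\<not> ?thesis"
  define S where "S = {n. h * real n ^ CARD('n) < ln (real (N n))}"
  have "infinite S"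
  proof
    assume "finite S"
    then obtain k where "\<forall>n\<in>S. n < k" using finite_nat_set_iff_bounded by blast
    then have "\<forall>n\<ge>k. n \<notin> S" by force
    then have "\<forall>\<^sub>F n in sequentially. n \<notin> S" 
      unfolding eventually_sequentially by blast
    then show False using not_ev unfolding S_def N_def by (simp add: not_less)
  qed
  define r where "r = enumerate S"
  have r: "strict_mono r" "\<And>k. r k \<in> S"
    unfolding r_def using \<open>infinite S\<close> by (auto simp: strict_mono_enumerate enumerate_in_set)
  have maps: "T u x \<in> X" if "x \<in> X" for u x
  proof -
    have "homeomorphic_map (top_of_set X) (top_of_set X) (T u)"
      using act unfolding homeo_action_def by blast
    then have "T u ` X = X" using homeomorphic_imp_surjective_map by fastforce
    then show ?thesis using that by blast
  qed
  have add: "T (u + v) x = T u (T v x)" if "x \<in> X" for u v x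
    using act that unfolding homeo_action_def by blast

  obtain e where e: "e > 0" "\<And>x. x \<in> X \<Longrightarrow> \<exists>G\<in>\<U>. ball x e \<inter> X \<subseteq> G"
    using open_cover_Lebesgue_number[OF \<open>compact X\<close> cover] by blast
  have "\<exists>E\<subseteq>X. finite E \<and> card E = N n \<and> (\<forall>x\<in>E. \<forall>y\<in>E. x \<noteq> y \<longrightarrow> (\<exists>u\<in>B n. e \<le> dist (T u x) (T u y)))" for n
    unfolding N_def B_def by (rule separated_set_exists[OF e(2) maps e(1)]) auto
  then obtain E where E: "\<And>n. E n \<subseteq> X" "\<And>n. finite (E n)" "\<And>n. card (E n) = N n"
    and sep: "\<And>n x y. x \<in> E n \<Longrightarrow> y \<in> E n \<Longrightarrow> x \<noteq> y \<Longrightarrow> \<exists>u\<in>B n. e \<le> dist (T u x) (T u y)"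
    by metis
  have SN: "N n > 0" "n > 0" if "n \<in> S" for n
  proof -
    have "0 \<le> h * real n ^ CARD('n)" using \<open>h > 0\<close> by simp
    then have "0 < ln (real (N n))" using that unfolding S_def by simp
    then show "N n > 0" by (cases "N n = 0") auto
    show "n > 0"
    proof (rule ccontr)
      assume "\<not> n > 0"
      then have n: "n = 0" by simp
      have "B n = {}" unfolding n B_def box_Zd_def by auto
      then have "x = y" if "x \<in> E n" "y \<in> E n" for x y using sep[OF that] by auto
      then have "card (E n) \<le> Suc 0" using card_le_Suc0_iff_eq[OF E(2)] by blast
      then have "N n \<le> 1" using E(3) by simp
      then show False using \<open>0 < ln (real (N n))\<close> \<open>N n > 0\<close> by (cases "N n = 1") auto
    qed
  qed
  have "X \<noteq> {}"
  proof
    assume "X = {}"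
    then have "E (r 0) = {}" using E(1) by auto
    then have "N (r 0) = 0" using E(3)[of "r 0"] by simp
    then show False using SN(1)[OF r(2)[of 0]] by simp
  qed
  obtain P where P: "finite P" "X \<subseteq> (\<Union>p\<in>P. ball p (e/8))"
  proof -
    have "e / 8 > 0" using e(1) by simp
    then show thesis
      using \<open>compact X\<close> that unfolding compact_eq_totally_bounded by blast
  qed
  have "P \<noteq> {}" using P(2) \<open>X \<noteq> {}\<close> by auto
  define k where "k = real (card P)"
  have k: "k > 0" using P(1) \<open>P \<noteq> {}\<close> by (simp add: k_def card_gt_0_iff)

  \<comment> \<open>\<open>M\<close> is chosen for the Kraft factor and \<open>R\<close> for the mean price: each contributes at most \<open>h/8\<close> per site of the box\<close>
  define M where "M = max 0 (- ln (h / (16 * k)))"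
  have M: "M \<ge> 0" "2 * exp (- M) * k \<le> h / 8"
  proof -
    have "exp (- M) \<le> exp (ln (h / (16 * k)))" unfolding M_def by simp
    also have "\<dots> = h / (16 * k)" using k \<open>h > 0\<close> by simp
    finally show "2 * exp (- M) * k \<le> h / 8" using k by (simp add: field_simps)
  qed (simp add: M_def)
  define L where "L = e / 8"
  define R where "R = min L (L * h / (16 * k * (M + 6)))"
  have L: "L > 0" using e by (simp add: L_def)
  have R: "R > 0" "R \<le> L" "2 * R * (M + 6) / L * k \<le> h / 8"
  proof -
    show "R > 0" unfolding R_def using L k M \<open>h > 0\<close> by simp
    show "R \<le> L" unfolding R_def by simp
    have "R \<le> L * h / (16 * k * (M + 6))" unfolding R_def by simp
    then have "R * (16 * k * (M + 6)) \<le> L * h"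
      using k M by (simp add: pos_le_divide_eq)
    then show "2 * R * (M + 6) / L * k \<le> h / 8"
      using L by (simp add: field_simps)
  qed

  define J where "J = (\<lambda>j. E (r j) \<times> (P \<times> B (r j)))"
  define \<tau> where "\<tau> = (\<lambda>(j::nat) (x, p, u). dist (T u x) p)"
  have finB: "finite (B n)" and cardB: "card (B n) = n ^ CARD('n)" for n
    unfolding B_def by (auto simp: finite_box_Zd card_box_Zd)
  have J: "finite (J j)" "J j \<noteq> {}" for j
  proof -
    show "finite (J j)" unfolding J_def using E(2) P(1) finB by blast
    have "card (J j) > 0"
      unfolding J_def card_cartesian_product using E(3) SN[OF r(2)] cardB P(1) \<open>P \<noteq> {}\<close>
      by (simp add: card_gt_0_iff)
    then show "J j \<noteq> {}" by auto
  qed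
  \<comment> \<open>the whole transition, from \<open>\<theta>\<close> to \<open>\<theta> + R\<close>, then lies between \<open>e/4\<close> and \<open>e/2\<close>\<close>
  obtain \<theta> where \<theta>: "e/4 \<le> \<theta>" "\<theta> \<le> e/4 + L" and
    freq: "\<exists>\<^sub>F j in sequentially. (\<Sum>i\<in>J j. cost M ((\<tau> j i - \<theta>) / R))
        \<le> ennreal (2 * R * (M + 6) / L * real (card (J j)))"
    using good_shift_exists[where J = J and \<tau> = \<tau> and a = "e/4", OF J R(1) L M(1)] by blast

  obtain \<phi> :: "real \<Rightarrow> real" where \<phi>: "continuous_on UNIV \<phi>" "\<And>t. t \<le> 0 \<Longrightarrow> \<phi> t = 0"
    "\<And>t. t \<ge> 1 \<Longrightarrow> \<phi> t = 1" "\<And>t. \<phi> t = (\<phi> (3 * t) + \<phi> (3 * t - 2)) / 2"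
    using cantor_function_exists by blast
  define F where "F = (\<lambda>p x :: 'a. \<phi> ((dist x p - \<theta>) / R))"
  have "continuous_on X (F p)" for p
    unfolding F_def
    by (rule continuous_on_compose2[OF \<phi>(1)]) (use R in \<open>auto intro!: continuous_intros\<close>)
  then have "\<exists>K. finite K \<and> (\<forall>v\<in>K. lex_less v 0) \<and>
    (\<forall>x\<in>X. \<forall>y\<in>X. (\<forall>v\<in>K. F p (T v x) = F p (T v y)) \<longrightarrow> \<bar>F p x - F p y\<bar> < 1)" for p
    by (intro predictable_finite_past[OF \<open>compact X\<close> tp maps]) auto
  then obtain K where K: "\<And>p. finite (K p)" "\<And>p v. v \<in> K p \<Longrightarrow> lex_less v 0"
    "\<And>p x y. x \<in> X \<Longrightarrow> y \<in> X \<Longrightarrow> \<forall>v\<in>K p. F p (T v x) = F p (T v y) \<Longrightarrow> \<bar>F p x - F p y\<bar> < 1"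
    by metis
  define KK where "KK = (\<Union>p\<in>P. K p)"
  define bd where "bd = (\<lambda>n. {u \<in> B n. \<exists>v\<in>KK. u + v \<notin> B n})"

  have bound: "real (N n) \<le> exp (2 * R * (M + 6) / L * (k * real n ^ CARD('n)))
      * (1 + 2 * exp (- M)) ^ (card P * card (B n)) * 2 ^ (card P * card (bd n))"
    if j: "(\<Sum>i\<in>J j. cost M ((\<tau> j i - \<theta>) / R)) \<le> ennreal (2 * R * (M + 6) / L * real (card (J j)))"
      and n: "n = r j" for j n
  proof -
    have "\<exists>l. (\<tau> j i - \<theta>) / R \<notin> unresolved l \<and> ennreal (level_cost M l) \<le> cost M ((\<tau> j i - \<theta>) / R)"
      if "i \<in> J j" for i
    proof -
      have "cost M ((\<tau> j i - \<theta>) / R) \<le> (\<Sum>i\<in>J j. cost M ((\<tau> j i - \<theta>) / R))"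
        by (rule member_le_sum[OF that]) (use J in auto)
      also have "\<dots> < \<infinity>" using j by (simp add: order_le_less_trans)
      finally show ?thesis using cost_level M(1) by metis
    qed
    then obtain l where l: "\<And>i. i \<in> J j \<Longrightarrow> (\<tau> j i - \<theta>) / R \<notin> unresolved (l i)"
      "\<And>i. i \<in> J j \<Longrightarrow> ennreal (level_cost M (l i)) \<le> cost M ((\<tau> j i - \<theta>) / R)"
      by metis
    define lev where "lev = (\<lambda>x i. l (x, i))"
    have lc: "level_cost M a \<ge> 0" for a using M(1) by (simp add: level_cost_def)
    have "ennreal (\<Sum>i\<in>J j. level_cost M (l i)) = (\<Sum>i\<in>J j. ennreal (level_cost M (l i)))"
      by (rule sum_ennreal[symmetric]) (rule lc)
    also have "\<dots> \<le> ennreal (2 * R * (M + 6) / L * real (card (J j)))"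
      using sum_mono[OF l(2)] j by (rule order_trans)
    finally have "(\<Sum>i\<in>J j. level_cost M (l i)) \<le> 2 * R * (M + 6) / L * real (card (J j))"
      using R L M by (simp add: ennreal_le_iff)
    moreover have "(\<Sum>i\<in>J j. level_cost M (l i)) = (\<Sum>x\<in>E n. \<Sum>i\<in>P \<times> B n. level_cost M (lev x i))"
      unfolding J_def n lev_def by (subst sum.cartesian_product) (auto intro!: sum.cong)
    moreover have "real (card (J j)) = (k * real n ^ CARD('n)) * real (card (E n))"
      unfolding J_def n by (simp add: card_cartesian_product cardB k_def)
    ultimately have mean: "(\<Sum>x\<in>E n. \<Sum>i\<in>P \<times> B n. level_cost M (lev x i))
        \<le> 2 * R * (M + 6) / L * (k * real n ^ CARD('n)) * real (card (E n))"
      by (simp add: mult.assoc)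
    have "real (card (E n)) \<le> exp (2 * R * (M + 6) / L * (k * real n ^ CARD('n)))
      * (1 + 2 * exp (- M)) ^ (card P * card (B n)) * 2 ^ (card P * card {u \<in> B n. \<exists>v\<in>KK. u + v \<notin> B n})"
    proof (rule card_le_of_predictable_codes[where X = X and T = T and F = F and lev = lev, OF E(2) P(1) finB _ E(1) maps add _ _ mean])
      show "lex_less v 0" if "v \<in> KK" for v using that K(2) unfolding KK_def by blast
      show "\<bar>F p x - F p y\<bar> < 1" if "p \<in> P" "x \<in> X" "y \<in> X" "\<forall>v\<in>KK. F p (T v x) = F p (T v y)" for p x y
        using that K(3)[of x y p] unfolding KK_def by blast
      show "F p (T u x) \<in> dyadic (lev x (p, u))" if "x \<in> E n" "p \<in> P" "u \<in> B n" for x p u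
      proof -
        have "(x, p, u) \<in> J j" using that unfolding J_def n by simp
        from cantor_function_resolved[OF \<phi>(2-4) l(1)[OF this]] show ?thesis
          unfolding F_def lev_def \<tau>_def by simp
      qed
      show "\<exists>p\<in>P. \<exists>u\<in>B n. F p (T u x) \<noteq> F p (T u y)" if xy: "x \<in> E n" "y \<in> E n" "x \<noteq> y" for x y
      proof -
        obtain u where u: "u \<in> B n" "e \<le> dist (T u x) (T u y)" using sep[OF xy] by blast
        have "T u x \<in> X" using maps E(1) xy by blast
        then obtain p where p: "p \<in> P" "dist p (T u x) < e/8" using P(2) by auto
        have "dist (T u x) (T u y) \<le> dist p (T u x) + dist (T u y) p"
          using dist_triangle2[of "T u x" "T u y" p] by (simp add: dist_commute)
        then have far: "dist (T u y) p \<ge> 7 * e / 8" using u p by argo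
        have "dist (T u x) p - \<theta> \<le> 0" using p \<theta> e(1) by (simp add: dist_commute)
        then have "F p (T u x) = 0"
          unfolding F_def using R(1) by (intro \<phi>(2)) (simp add: divide_nonpos_pos)
        moreover have "R \<le> dist (T u y) p - \<theta>" using far \<theta> R(2) e(1) unfolding L_def by argo
        then have "F p (T u y) = 1"
          unfolding F_def using R(1) by (intro \<phi>(3)) (simp add: le_divide_eq_1_pos)
        ultimately have "F p (T u x) \<noteq> F p (T u y)" by simp
        then show ?thesis using p(1) u(1) by blast
      qed
    qed
    then show ?thesis by (simp add: E(3) bd_def)
  qed
  have "finite KK" unfolding KK_def using P K by auto
  then have "\<forall>\<^sub>F n in sequentially. real (card (bd n)) \<le> h / (4 * k) * real n ^ CARD('n)"
    unfolding bd_def B_def by (rule box_Zd_boundary) (use \<open>h > 0\<close> k in simp)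
  then have "\<forall>\<^sub>F j in sequentially. real (card (bd (r j))) \<le> h / (4 * k) * real (r j) ^ CARD('n)"
    using filterlim_subseq[OF r(1)] by (rule eventually_compose_filterlim)
  from frequently_eventually_conj[OF freq this]
  obtain j where j: "(\<Sum>i\<in>J j. cost M ((\<tau> j i - \<theta>) / R)) \<le> ennreal (2 * R * (M + 6) / L * real (card (J j)))"
    and bdj: "real (card (bd (r j))) \<le> h / (4 * k) * real (r j) ^ CARD('n)"
    using frequently_ex by blast
  define n where "n = r j"
  define V where "V = real n ^ CARD('n)"
  have "V > 0" using SN(2)[OF r(2)[of j]] unfolding V_def n_def by simp
  have "ln (real (N n)) \<le> ln (exp (2 * R * (M + 6) / L * (k * V))
      * (1 + 2 * exp (- M)) ^ (card P * card (B n)) * 2 ^ (card P * card (bd n)))"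
    using bound[OF j n_def] SN(1)[OF r(2)[of j]] unfolding V_def n_def
    by (subst ln_le_cancel_iff) (auto intro!: mult_pos_pos add_pos_pos)
  also have "\<dots> = 2 * R * (M + 6) / L * (k * V) + (k * V) * ln (1 + 2 * exp (- M)) + k * real (card (bd n)) * ln 2"
  proof -
    have "1 + 2 * exp (- M) \<noteq> 0" using exp_gt_zero[of "- M"] by linarith
    then show ?thesis by (simp add: ln_mult ln_realpow cardB k_def V_def)
  qed
  also have "\<dots> \<le> h / 8 * V + h / 8 * V + h / 4 * V"
  proof (intro add_mono)
    show "2 * R * (M + 6) / L * (k * V) \<le> h / 8 * V"
      using mult_right_mono[OF R(3), of V] \<open>V > 0\<close> by (simp add: mult.assoc)
    have "(k * V) * ln (1 + 2 * exp (- M)) \<le> (k * V) * (2 * exp (- M))"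
      using k \<open>V > 0\<close> by (intro mult_left_mono ln_add_one_self_le_self) auto
    also have "\<dots> \<le> h / 8 * V"
      using mult_right_mono[OF M(2), of V] \<open>V > 0\<close> by (simp add: mult_ac)
    finally show "(k * V) * ln (1 + 2 * exp (- M)) \<le> h / 8 * V" .
    have "k * real (card (bd n)) * ln 2 \<le> k * real (card (bd n)) * 1"
      using k ln_le_minus_one[of 2] by (intro mult_left_mono) auto
    also have "\<dots> \<le> k * (h / (4 * k) * V)"
      using mult_left_mono[OF bdj less_imp_le[OF k]] unfolding n_def V_def mult_1_right .
    also have "\<dots> = h / 4 * V" using k by simp
    finally show "k * real (card (bd n)) * ln 2 \<le> h / 4 * V" .
  qed
  also have "\<dots> < h * V" using \<open>h > 0\<close> \<open>V > 0\<close> by (simp add: field_simps)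
  finally have "ln (real (N n)) < h * V" .
  then show False using r(2)[of j] unfolding n_def V_def S_def by simp
qed

theorem theorem1p3:
  fixes X :: "'a::metric_space set"
    and T :: "int ^ 'n::{finite,linorder} \<Rightarrow> 'a \<Rightarrow> 'a"
  assumes "compact X"
    and "homeo_action X T"
    and "topologically_predictable X T"
  shows "topological_entropy X T = 0"
proof (rule antisym)
  show "topological_entropy X T \<le> 0"
    unfolding topological_entropy_def
  proof (rule SUP_least, unfold mem_Collect_eq)
    fix \<U> assume cover: "open_cover X \<U>"
    show "cover_entropy X T \<U> \<le> 0"
    proof (rule ereal_le_epsilon2)
      fix h :: real assume "0 < h"
      have "\<forall>\<^sub>F n in sequentially. ereal (ln (real (cover_number X (cover_join X T \<U> (box_Zd n)))) / real n ^ CARD('n)) \<le> ereal h"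
        using cover_number_growth[OF assms cover \<open>0 < h\<close>] eventually_gt_at_top[of 0]
        by eventually_elim (simp add: pos_divide_le_eq)
      then show "cover_entropy X T \<U> \<le> 0 + ereal h"
        unfolding cover_entropy_def by (simp add: Limsup_bounded)
    qed
  qed
next
  have "open_cover X {X}" by (simp add: open_cover_def)
  moreover have "0 \<le> cover_entropy X T {X}"
  proof -
    have "0 \<le> ln (real m)" for m :: nat by (cases "m = 0") auto
    then have "0 \<le> limsup (\<lambda>n. ereal (ln (real (cover_number X (cover_join X T {X} (box_Zd n)))) / real n ^ CARD('n)))"
      by (intro le_Limsup) auto
    then show ?thesis unfolding cover_entropy_def .
  qed
  ultimately show "0 \<le> topological_entropy X T"
    unfolding topological_entropy_def by (intro SUP_upper2) auto
qed

end
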